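(* Let $\gamma>0$, $a>0$, and let $\mathcal Z\subseteq\mathbb R^d$ be a nonempty compact convex set. Given a fixed $\bm y\in\mathcal Y\subseteq\mathbb R^d$, it holds that: (i) $0\le\ell_{\mathcal{RSPO}}(\hat{\bm y},\bm y)\le\ell_{\mathcal{RSPO}_+}(\hat{\bm y},\bm y)$ for all $\hat{\bm y}\in\mathbb R^d$; (ii) $\ell_{\mathcal{RSPO}_+}(\cdot,\bm y)$ is convex on $\mathbb R^d$; (iii) $\ell_{\mathcal{RSPO}_+}(\cdot,\bm y)$ is differentiable everywhere, with gradient at $\hat{\bm y}$ given by $a\big(\bm z^\star_\gamma(\bm y)-\bm z^\star_\gamma(\hat{\bm y}-\frac1a\bm y)\big)$; (iv) $\ell_{\mathcal{RSPO}_+}(\cdot,\bm y)$ is $a D_{\mathcal Z}$-Lipschitz continuous, where $D_{\mathcal Z}:=\sup_{\bm z_1,\bm z_2\in\mathcal Z}\|\bm z_1-\bm z_2\|_2$.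
   Context: $v^\star(\bm y)=\min_{\bm z\in\mathcal Z}\bm y^\top\bm z$; $\bm z^\star_\gamma(\bm y)$ is the unique minimizer of $\bm y^\top\bm z+\frac{\gamma}{2}\|\bm z\|_2^2$ over $\bm z\in\mathcal Z$. $\ell_{\mathcal{RSPO}}(\hat{\bm y},\bm y)=\bm y^\top\bm z^\star_\gamma(\hat{\bm y})-v^\star(\bm y)$. $\ell_{\mathcal{RSPO}_+}(\hat{\bm y},\bm y)=\max_{\bm z\in\mathcal Z}\{\bm y^\top\bm z-a\hat{\bm y}^\top\bm z-\frac{a\gamma}{2}\|\bm z\|_2^2\}+a\{\bm z^\star_\gamma(\bm y)^\top\hat{\bm y}+\frac{\gamma}{2}\|\bm z^\star_\gamma(\bm y)\|_2^2\}-v^\star(\bm y)$. Lipschitz continuity is with respect to the Euclidean norm. *)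

theory Defs
  imports "HOL-Analysis.Analysis"
begin

definition v_star :: "(real ^ 'n) set \<Rightarrow> real ^ 'n \<Rightarrow> real" where
  "v_star Z y = (INF z\<in>Z. y \<bullet> z)"

definition reg_obj :: "real \<Rightarrow> real ^ 'n \<Rightarrow> real ^ 'n \<Rightarrow> real" where
  "reg_obj \<gamma> y z = y \<bullet> z + \<gamma> / 2 * (norm z)\<^sup>2"

definition z_star :: "(real ^ 'n) set \<Rightarrow> real \<Rightarrow> real ^ 'n \<Rightarrow> real ^ 'n" where
  "z_star Z \<gamma> y = (THE z. is_arg_min (reg_obj \<gamma> y) (\<lambda>z. z \<in> Z) z)"

definition loss_RSPO :: "(real ^ 'n) set \<Rightarrow> real \<Rightarrow> real ^ 'n \<Rightarrow> real ^ 'n \<Rightarrow> real" where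
  "loss_RSPO Z \<gamma> yhat y = y \<bullet> z_star Z \<gamma> yhat - v_star Z y"

definition loss_RSPO_plus ::
    "(real ^ 'n) set \<Rightarrow> real \<Rightarrow> real \<Rightarrow> real ^ 'n \<Rightarrow> real ^ 'n \<Rightarrow> real" where
  "loss_RSPO_plus Z \<gamma> a yhat y =
     (SUP z\<in>Z. y \<bullet> z - a * (yhat \<bullet> z) - a * \<gamma> / 2 * (norm z)\<^sup>2)
     + a * (z_star Z \<gamma> y \<bullet> yhat + \<gamma> / 2 * (norm (z_star Z \<gamma> y))\<^sup>2)
     - v_star Z y"

text \<open>The infimum and supremum above are attained on a nonempty compact set, and the
  minimizer picked by the description operator exists uniquely when the set is also convex.\<close>

lemma v_star_attained:
  assumes "compact Z" "Z \<noteq> {}"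
  shows "\<exists>z\<in>Z. v_star Z y = y \<bullet> z \<and> (\<forall>w\<in>Z. y \<bullet> z \<le> y \<bullet> w)"
proof -
  have "continuous_on Z (\<lambda>z. y \<bullet> z)"
    by (intro continuous_intros)
  then obtain z where z: "z \<in> Z" "\<forall>w\<in>Z. y \<bullet> z \<le> y \<bullet> w"
    using continuous_attains_inf[OF assms] by blast
  then have "v_star Z y = y \<bullet> z"
    unfolding v_star_def by (intro cInf_eq_minimum) auto
  with z show ?thesis by blast
qed

lemma SUP_attained:
  fixes y yhat :: "real ^ 'n" and a \<gamma> :: real
  assumes "compact Z" "Z \<noteq> {}"
  defines "g \<equiv> \<lambda>z. y \<bullet> z - a * (yhat \<bullet> z) - a * \<gamma> / 2 * (norm z)\<^sup>2"
  shows "\<exists>z\<in>Z. (SUP z\<in>Z. g z) = g z \<and> (\<forall>w\<in>Z. g w \<le> g z)"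
proof -
  have "continuous_on Z g"
    unfolding g_def by (intro continuous_intros)
  then obtain z where z: "z \<in> Z" "\<forall>w\<in>Z. g w \<le> g z"
    using continuous_attains_sup[OF assms(1,2)] by blast
  then have "(SUP z\<in>Z. g z) = g z"
    by (intro cSup_eq_maximum) auto
  with z show ?thesis by blast
qed

lemma ex1_is_arg_min_reg_obj:
  fixes y :: "real ^ 'n"
  assumes "compact Z" "convex Z" "Z \<noteq> {}" "\<gamma> > 0"
  shows "\<exists>!z. is_arg_min (reg_obj \<gamma> y) (\<lambda>z. z \<in> Z) z"
proof -
  have "continuous_on Z (reg_obj \<gamma> y)"
    unfolding reg_obj_def by (intro continuous_intros)
  then obtain z where z: "z \<in> Z" "\<forall>w\<in>Z. reg_obj \<gamma> y z \<le> reg_obj \<gamma> y w"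
    using continuous_attains_inf[OF assms(1,3)] by blast
  have uniq: "w = z" if w: "is_arg_min (reg_obj \<gamma> y) (\<lambda>z. z \<in> Z) w" for w
  proof -
    have wZ: "w \<in> Z" and le: "reg_obj \<gamma> y w \<le> reg_obj \<gamma> y z"
      using w z(1) by (auto simp: is_arg_min_linorder)
    define m where "m = (1/2) *\<^sub>R z + (1/2) *\<^sub>R w"
    have "m \<in> Z"
      unfolding m_def using convexD[OF assms(2) z(1) wZ, of "1/2" "1/2"] by simp
    then have "reg_obj \<gamma> y z \<le> reg_obj \<gamma> y m"
      using z(2) by blast
    moreover have "reg_obj \<gamma> y m
        = (reg_obj \<gamma> y z + reg_obj \<gamma> y w) / 2 - \<gamma> / 8 * (norm (z - w))\<^sup>2"
      unfolding reg_obj_def m_def power2_norm_eq_inner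
      by (simp add: inner_simps inner_commute[of w z] field_simps)
    ultimately have "\<gamma> / 8 * (norm (z - w))\<^sup>2 \<le> 0"
      using le by argo
    then show "w = z"
      using assms(4) by (simp add: mult_le_0_iff)
  qed
  show ?thesis
  proof (rule ex1I)
    show "is_arg_min (reg_obj \<gamma> y) (\<lambda>z. z \<in> Z) z"
      using z by (simp add: is_arg_min_linorder)
  qed (rule uniq)
qed

lemma is_arg_min_z_star:
  fixes y :: "real ^ 'n"
  assumes "compact Z" "convex Z" "Z \<noteq> {}" "\<gamma> > 0"
  shows "is_arg_min (reg_obj \<gamma> y) (\<lambda>z. z \<in> Z) (z_star Z \<gamma> y)"
  unfolding z_star_def by (rule theI') (rule ex1_is_arg_min_reg_obj[OF assms])

end

theory Submission
  imports Defs
begin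

text \<open>
  Completing the square shows that \<open>z_star Z \<gamma> u\<close> is the Euclidean projection of
  \<open>- u / \<gamma>\<close> onto \<open>Z\<close>, so it depends continuously on \<open>u\<close>. Comparing the value of the regularised
  problem at \<open>v\<close> with the objective at the minimiser for \<open>u\<close> shows that
  \<open>a (z_star Z \<gamma> y - z_star Z \<gamma> (u - y / a))\<close> is a subgradient of the RSPO+ loss at \<open>u\<close>.
  A function with a subgradient everywhere is convex; it is differentiable where the subgradient
  is continuous, and Lipschitz when the subgradient is bounded.
\<close>

text \<open>Averaging the two supporting inequalities at the intermediate point \<open>p\<close>,
  with weights \<open>1 - t\<close> and \<open>t\<close>, bounds \<open>f p\<close>: the weighted
  displacements \<open>x - p\<close> and \<open>y - p\<close> sum to zero.\<close>

lemma convex_on_if_subgradient: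
  fixes f :: "'a::real_inner \<Rightarrow> real"
  assumes sub: "\<And>u v. f u + g u \<bullet> (v - u) \<le> f v"
  shows "convex_on UNIV f"
proof (rule convex_onI)
  fix t :: real and x y :: 'a
  assume t: "0 < t" "t < 1"
  define p where "p = (1 - t) *\<^sub>R x + t *\<^sub>R y"
  have "(1 - t) * (f p + g p \<bullet> (x - p)) + t * (f p + g p \<bullet> (y - p)) \<le> (1 - t) * f x + t * f y"
    using t by (intro add_mono mult_left_mono sub) auto
  moreover have "(1 - t) * (f p + g p \<bullet> (x - p)) + t * (f p + g p \<bullet> (y - p))
      = f p + g p \<bullet> ((1 - t) *\<^sub>R x + t *\<^sub>R y - p)"
    by (simp add: inner_simps algebra_simps)
  ultimately show "f ((1 - t) *\<^sub>R x + t *\<^sub>R y) \<le> (1 - t) * f x + t * f y"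
    by (simp add: p_def)
qed auto

text \<open>The subgradient at \<open>x\<close> makes the first-order remainder nonnegative, and the
  subgradient at \<open>v\<close> bounds it above by \<open>(g v - g x) \<bullet> (v - x)\<close>.
  After division by \<open>norm (v - x)\<close>, continuity of \<open>g\<close> at \<open>x\<close>
  finishes.\<close>

lemma GDERIV_if_subgradient:
  fixes f :: "'a::real_inner \<Rightarrow> real"
  assumes sub: "\<And>u v. f u + g u \<bullet> (v - u) \<le> f v"
    and cont: "isCont g x"
  shows "GDERIV f x :> g x"
  unfolding gderiv_def
\<comment> \<open>The radius 1 is arbitrary, since the bound holds for every
  \<open>v \<noteq> x\<close>.\<close>
proof (rule has_derivativeI_sandwich[of 1])
  show "bounded_linear (\<lambda>h. h \<bullet> g x)"
    by (rule bounded_linear_inner_left)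
  show "norm (f v - f x - (v - x) \<bullet> g x) / norm (v - x) \<le> norm (g v - g x)"
    if "v \<noteq> x" for v
  proof -
    have "f v - f x - (v - x) \<bullet> g x \<le> (g v - g x) \<bullet> (v - x)"
      using sub[of v x] by (simp add: inner_simps inner_commute)
    also have "\<dots> \<le> norm (g v - g x) * norm (v - x)"
      by (rule norm_cauchy_schwarz)
    \<comment> \<open>The subgradient inequality at \<open>x\<close> gives the remainder its sign,
      so the norm is the remainder itself.\<close>
    finally have "norm (f v - f x - (v - x) \<bullet> g x) \<le> norm (g v - g x) * norm (v - x)"
      using sub[of x v] by (simp add: inner_commute)
    with that show ?thesis
      by (simp add: divide_le_eq)
  qed
  show "((\<lambda>v. norm (g v - g x)) \<longlongrightarrow> 0) (at x)"
    using cont by (simp add: isCont_def LIM_zero tendsto_norm_zero)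
qed simp

lemma lipschitz_on_if_subgradient:
  fixes f :: "'a::real_inner \<Rightarrow> real"
  assumes sub: "\<And>u v. f u + g u \<bullet> (v - u) \<le> f v"
    and bound: "\<And>u. norm (g u) \<le> C"
  shows "C-lipschitz_on UNIV f"
proof (rule lipschitz_onI)
  have le: "f u - f v \<le> C * norm (u - v)" for u v
  proof -
    have "f u - f v \<le> g u \<bullet> (u - v)"
      using sub[of u v] by (simp add: inner_simps)
    also have "\<dots> \<le> norm (g u) * norm (u - v)"
      by (rule norm_cauchy_schwarz)
    also have "\<dots> \<le> C * norm (u - v)"
      by (intro mult_right_mono bound) simp
    finally show ?thesis .
  qed
  show "dist (f u) (f v) \<le> C * dist u v" for u v
    using le[of u v] le[of v u] by (simp add: dist_norm norm_minus_commute abs_le_iff)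
  show "0 \<le> C"
    using bound[of 0] norm_ge_zero order_trans by blast
qed

lemma z_star_in:
  fixes y :: "real ^ 'n"
  assumes "compact Z" "convex Z" "Z \<noteq> {}" "\<gamma> > 0"
  shows "z_star Z \<gamma> y \<in> Z"
  using is_arg_min_z_star[OF assms] by (simp add: is_arg_min_linorder)

lemma reg_obj_z_star_le:
  fixes y :: "real ^ 'n"
  assumes "compact Z" "convex Z" "Z \<noteq> {}" "\<gamma> > 0" "w \<in> Z"
  shows "reg_obj \<gamma> y (z_star Z \<gamma> y) \<le> reg_obj \<gamma> y w"
  using is_arg_min_z_star[OF assms(1-4)] assms(5) by (simp add: is_arg_min_linorder)

text \<open>The last term is independent of \<open>z\<close>, so minimising over \<open>z\<close>
  amounts to minimising the distance.\<close>

lemma reg_obj_complete_square: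
  assumes "\<gamma> > 0"
  shows "reg_obj \<gamma> y z = \<gamma> / 2 * (dist (- (1 / \<gamma>) *\<^sub>R y) z)\<^sup>2 - (norm y)\<^sup>2 / (2 * \<gamma>)"
  using assms unfolding reg_obj_def dist_norm power2_norm_eq_inner
  by (simp add: inner_simps inner_commute field_simps)

lemma z_star_eq_closest_point:
  fixes y :: "real ^ 'n"
  assumes "compact Z" "convex Z" "Z \<noteq> {}" "\<gamma> > 0"
  shows "z_star Z \<gamma> y = closest_point Z (- (1 / \<gamma>) *\<^sub>R y)"
proof (rule closest_point_unique)
  show "\<forall>w\<in>Z. dist (- (1 / \<gamma>) *\<^sub>R y) (z_star Z \<gamma> y) \<le> dist (- (1 / \<gamma>) *\<^sub>R y) w"
  proof
    fix w assume "w \<in> Z"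
    from reg_obj_z_star_le[OF assms this, of y] \<open>\<gamma> > 0\<close>
    have "(dist (- (1 / \<gamma>) *\<^sub>R y) (z_star Z \<gamma> y))\<^sup>2 \<le> (dist (- (1 / \<gamma>) *\<^sub>R y) w)\<^sup>2"
      by (simp add: reg_obj_complete_square)
    then show "dist (- (1 / \<gamma>) *\<^sub>R y) (z_star Z \<gamma> y) \<le> dist (- (1 / \<gamma>) *\<^sub>R y) w"
      by (rule power2_le_imp_le) simp
  qed
qed (use assms z_star_in compact_imp_closed in auto)

lemma continuous_on_z_star:
  fixes Z :: "(real ^ 'n) set"
  assumes "compact Z" "convex Z" "Z \<noteq> {}" "\<gamma> > 0"
  shows "continuous_on UNIV (z_star Z \<gamma>)"
proof -
  \<comment> \<open>Projection onto a nonempty closed convex set is continuous.\<close>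
  have "continuous_on UNIV (closest_point Z)"
    using assms by (intro continuous_on_closest_point compact_imp_closed)
  then have "continuous_on UNIV (\<lambda>y. closest_point Z (- (1 / \<gamma>) *\<^sub>R y))"
    by (rule continuous_on_compose2) (auto intro!: continuous_intros)
  then show ?thesis
    by (simp add: z_star_eq_closest_point[OF assms] cong: continuous_on_cong)
qed

lemma loss_RSPO_nonneg:
  fixes y :: "real ^ 'n"
  assumes "compact Z" "convex Z" "Z \<noteq> {}" "\<gamma> > 0"
  shows "0 \<le> loss_RSPO Z \<gamma> yhat y"
  using v_star_attained[OF assms(1,3), of y] z_star_in[OF assms, of yhat]
  unfolding loss_RSPO_def by force

text \<open>Factoring \<open>- a\<close> out of the maximand leaves the regularised objective with
  cost shifted by \<open>y / a\<close>. As \<open>a > 0\<close>, the maximum is attained at the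
  minimiser for the shifted cost \<open>u\<close>.\<close>

lemma SUP_eq_reg_obj:
  fixes y yhat :: "real ^ 'n"
  assumes "compact Z" "convex Z" "Z \<noteq> {}" "\<gamma> > 0" "a > 0"
  defines "u \<equiv> yhat - (1 / a) *\<^sub>R y"
  shows "(SUP z\<in>Z. y \<bullet> z - a * (yhat \<bullet> z) - a * \<gamma> / 2 * (norm z)\<^sup>2)
    = - a * reg_obj \<gamma> u (z_star Z \<gamma> u)"
proof -
  have eq: "y \<bullet> z - a * (yhat \<bullet> z) - a * \<gamma> / 2 * (norm z)\<^sup>2 = - a * reg_obj \<gamma> u z" for z
    using assms(5) unfolding reg_obj_def u_def by (simp add: inner_simps field_simps)
  show ?thesis
    unfolding eq using z_star_in[OF assms(1-4), of u] reg_obj_z_star_le[OF assms(1-4), of _ u] assms(5)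
    by (intro cSup_eq_maximum) auto
qed

lemma loss_RSPO_plus_eq:
  fixes y yhat :: "real ^ 'n"
  assumes "compact Z" "convex Z" "Z \<noteq> {}" "\<gamma> > 0" "a > 0"
  defines "u \<equiv> yhat - (1 / a) *\<^sub>R y"
  shows "loss_RSPO_plus Z \<gamma> a yhat y
    = a * (reg_obj \<gamma> yhat (z_star Z \<gamma> y) - reg_obj \<gamma> u (z_star Z \<gamma> u)) - v_star Z y"
  unfolding loss_RSPO_plus_def SUP_eq_reg_obj[OF assms(1-5)] u_def
  by (simp add: reg_obj_def inner_commute algebra_simps)

text \<open>Two optimality comparisons suffice: \<open>z_star Z \<gamma> yhat\<close> is a
  competitor for the cost \<open>u\<close>, and \<open>z_star Z \<gamma> y\<close> is one for the
  cost \<open>yhat\<close>. The term \<open>v_star Z y\<close> occurs on both sides.\<close>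

lemma loss_RSPO_le_loss_RSPO_plus:
  fixes y :: "real ^ 'n"
  assumes "compact Z" "convex Z" "Z \<noteq> {}" "\<gamma> > 0" "a > 0"
  shows "loss_RSPO Z \<gamma> yhat y \<le> loss_RSPO_plus Z \<gamma> a yhat y"
proof -
  define u where "u = yhat - (1 / a) *\<^sub>R y"
  have "reg_obj \<gamma> u (z_star Z \<gamma> u) \<le> reg_obj \<gamma> u (z_star Z \<gamma> yhat)"
    using assms by (intro reg_obj_z_star_le z_star_in)
  also have "\<dots> = reg_obj \<gamma> yhat (z_star Z \<gamma> yhat) - (y \<bullet> z_star Z \<gamma> yhat) / a"
    by (simp add: reg_obj_def u_def inner_simps)
  also have "\<dots> \<le> reg_obj \<gamma> yhat (z_star Z \<gamma> y) - (y \<bullet> z_star Z \<gamma> yhat) / a"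
    using assms by (intro diff_right_mono reg_obj_z_star_le z_star_in)
  finally have "y \<bullet> z_star Z \<gamma> yhat
      \<le> a * (reg_obj \<gamma> yhat (z_star Z \<gamma> y) - reg_obj \<gamma> u (z_star Z \<gamma> u))"
    using assms(5) by (simp add: field_simps)
  then show ?thesis
    by (simp add: loss_RSPO_def loss_RSPO_plus_eq[OF assms] u_def)
qed

text \<open>For a fixed decision \<open>z\<close> the objective is affine in the cost with slope
  \<open>z\<close>. The optimal value is therefore a minimum of affine functions, hence concave, and
  it enters the loss with factor \<open>- a\<close>.\<close>

lemma loss_RSPO_plus_subgradient:
  fixes y u v :: "real ^ 'n"
  assumes "compact Z" "convex Z" "Z \<noteq> {}" "\<gamma> > 0" "a > 0"
  shows "loss_RSPO_plus Z \<gamma> a u y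
      + a *\<^sub>R (z_star Z \<gamma> y - z_star Z \<gamma> (u - (1 / a) *\<^sub>R y)) \<bullet> (v - u)
    \<le> loss_RSPO_plus Z \<gamma> a v y"
proof -
  define p q where "p = u - (1 / a) *\<^sub>R y" and "q = v - (1 / a) *\<^sub>R y"
  have "reg_obj \<gamma> q (z_star Z \<gamma> q) \<le> reg_obj \<gamma> q (z_star Z \<gamma> p)"
    using assms by (intro reg_obj_z_star_le z_star_in)
  also have "\<dots> = reg_obj \<gamma> p (z_star Z \<gamma> p) + z_star Z \<gamma> p \<bullet> (v - u)"
    by (simp add: reg_obj_def p_def q_def inner_simps inner_commute)
  finally have "a * reg_obj \<gamma> q (z_star Z \<gamma> q)
      \<le> a * (reg_obj \<gamma> p (z_star Z \<gamma> p) + z_star Z \<gamma> p \<bullet> (v - u))"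
    using assms(5) by simp
  \<comment> \<open>Here the decision does not vary with the prediction, so the affine expansion is
    exact.\<close>
  moreover have "a * reg_obj \<gamma> v (z_star Z \<gamma> y)
      = a * (reg_obj \<gamma> u (z_star Z \<gamma> y) + z_star Z \<gamma> y \<bullet> (v - u))"
    by (simp add: reg_obj_def inner_simps inner_commute)
  ultimately show ?thesis
    unfolding loss_RSPO_plus_eq[OF assms] p_def[symmetric] q_def[symmetric]
    by (simp add: inner_diff_left algebra_simps)
qed

text \<open>A real supremum dominates its members once the set is bounded above; twice a norm bound
  for \<open>Z\<close> provides this.\<close>

lemma norm_diff_le_SUP:
  fixes Z :: "'a::real_normed_vector set"
  assumes "bounded Z" "w \<in> Z" "z \<in> Z"
  shows "norm (w - z) \<le> (SUP (z1, z2)\<in>Z \<times> Z. norm (z1 - z2))"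
proof -
  obtain B where B: "\<And>x. x \<in> Z \<Longrightarrow> norm x \<le> B"
    using assms(1) by (auto simp: bounded_iff)
  have "bdd_above ((\<lambda>(z1, z2). norm (z1 - z2)) ` (Z \<times> Z))"
    by (rule bdd_aboveI[of _ "B + B"]) (use B in \<open>fastforce intro: norm_triangle_le_diff add_mono\<close>)
  then show ?thesis
    using assms cSUP_upper[of "(w, z)" "Z \<times> Z" "\<lambda>(z1, z2). norm (z1 - z2)"] by simp
qed

theorem proposition3:
  fixes Z Y :: "(real ^ 'n) set" and y :: "real ^ 'n" and \<gamma> a :: real
  assumes "\<gamma> > 0" and "a > 0"
    and "Z \<noteq> {}" and "compact Z" and "convex Z"
    and "y \<in> Y"
  shows "(\<forall>yhat. 0 \<le> loss_RSPO Z \<gamma> yhat y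
            \<and> loss_RSPO Z \<gamma> yhat y \<le> loss_RSPO_plus Z \<gamma> a yhat y)
    \<and> convex_on UNIV (\<lambda>yhat. loss_RSPO_plus Z \<gamma> a yhat y)
    \<and> (\<forall>yhat. GDERIV (\<lambda>yhat. loss_RSPO_plus Z \<gamma> a yhat y) yhat
            :> a *\<^sub>R (z_star Z \<gamma> y - z_star Z \<gamma> (yhat - (1 / a) *\<^sub>R y)))
    \<and> (a * (SUP (z1, z2)\<in>Z \<times> Z. norm (z1 - z2)))-lipschitz_on UNIV
        (\<lambda>yhat. loss_RSPO_plus Z \<gamma> a yhat y)"
proof -
  note Z = assms(4,5,3,1)
  define g where "g u = a *\<^sub>R (z_star Z \<gamma> y - z_star Z \<gamma> (u - (1 / a) *\<^sub>R y))" for u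
  have sub: "loss_RSPO_plus Z \<gamma> a u y + g u \<bullet> (v - u) \<le> loss_RSPO_plus Z \<gamma> a v y" for u v
    unfolding g_def by (rule loss_RSPO_plus_subgradient[OF Z assms(2)])
  have "continuous_on UNIV (\<lambda>u. z_star Z \<gamma> (u - (1 / a) *\<^sub>R y))"
    by (rule continuous_on_compose2[OF continuous_on_z_star[OF Z]])
      (auto intro!: continuous_intros)
  then have "continuous_on UNIV g"
    unfolding g_def by (intro continuous_intros)
  then have cont: "isCont g u" for u
    by (simp add: continuous_on_eq_continuous_at)
  \<comment> \<open>Up to the factor \<open>a\<close>, \<open>g u\<close> is a difference of two
    points of \<open>Z\<close>.\<close>
  have bound: "norm (g u) \<le> a * (SUP (z1, z2)\<in>Z \<times> Z. norm (z1 - z2))" for u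
    using norm_diff_le_SUP[OF compact_imp_bounded[OF assms(4)] z_star_in[OF Z] z_star_in[OF Z]] assms(2)
    by (simp add: g_def)
  show ?thesis
    unfolding g_def[symmetric]
    using loss_RSPO_nonneg[OF Z] loss_RSPO_le_loss_RSPO_plus[OF Z assms(2)]
      convex_on_if_subgradient[of "\<lambda>u. loss_RSPO_plus Z \<gamma> a u y", OF sub]
      GDERIV_if_subgradient[of "\<lambda>u. loss_RSPO_plus Z \<gamma> a u y", OF sub cont]
      lipschitz_on_if_subgradient[of "\<lambda>u. loss_RSPO_plus Z \<gamma> a u y", OF sub bound]
    by blast
qed

end
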